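(* Let $i,j\ge 1$ be integers and let $G=S(i,i,j,j)$ be the 4-star with two rays of $i$ vertices and two rays of $j$ vertices. Then there is a one-parameter family $(u_s)_{s\in I}$, with $I\subset\mathbb{R}$ a nondegenerate interval, of pairwise non-equivalent bi-unitary connections for the inclusions $$\begin{array}{ccc} A_{1,0}&\stackrel{G^t}{\subset}&A_{1,1}\\ \cup_{G}& &\cup_{G^t}\\ A_{0,0}&\stackrel{G}{\subset}&A_{0,1}\end{array}$$ (equivalently, of pairwise non-equivalent commuting squares of finite-dimensional C*-algebras with these inclusion graphs).
   Context: The $m$-star $S(k_1,\dots,k_m)$ is the tree consisting of a central vertex $A$ of valency $m$ with $m$ linear rays attached to it, the $l$-th ray having $k_l$ vertices (not counting $A$). Bipartition its vertices as $V_0\ni A$ (even distance from $A$) and $V_1$ (odd distance). In the square of inclusions, the minimal central projections of $A_{0,0}$ and $A_{1,1}$ are indexed by $V_0$ and those of $A_{1,0}$ and $A_{0,1}$ by $V_1$; all four inclusions are described by the edges of $G$ (all edges are simple). Let $\mu$ be the (positive) Perron-Frobenius eigenvector of the adjacency matrix of $G$. For $p,s\in V_0$ and $q,r\in V_1$ such that each of $q,r$ is adjacent to both $p$ and $s$, set $w(p,q,r,s)=\sqrt{\frac{\mu(p)\mu(s)}{\mu(q)\mu(r)}}$. A bi-unitary connection is a family of complex numbers $u^{(p,s)}_{q,r}$, one for each such quadruple, such that (1) for every $(p,s)$ joined by a path of length 2, the matrix $u^{(p,s)}=(u^{(p,s)}_{q,r})_{q,r}$ is unitary, and (2) for every $(q,r)$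 joined by a path of length 2, the matrix $v^{(q,r)}=(v^{(q,r)}_{p,s})_{p,s}$, with $v^{(q,r)}_{p,s}=w(p,q,r,s)\,\overline{u^{(p,s)}_{q,r}}$, is unitary. The existence of a bi-unitary connection is equivalent to the existence of a commuting square with the given inclusion graphs. Two connections $u,\tilde u$ are (gauge) equivalent if there are unit complex numbers $a(p,q)$, $b(q,s)$, $c(p,r)$, $d(r,s)$ attached to the edges of the four inclusions $A_{0,0}\subset A_{1,0}$, $A_{1,0}\subset A_{1,1}$, $A_{0,0}\subset A_{0,1}$, $A_{0,1}\subset A_{1,1}$ with $\tilde u^{(p,s)}_{q,r}=a(p,q)\,b(q,s)\,c(p,r)\,d(r,s)\,u^{(p,s)}_{q,r}$ for all quadruples. *)

theory Defs
  imports "HOL-Analysis.Analysis" "Graph_Theory.Pair_Digraph"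
begin

section \<open>Stars\<close>

text \<open>\<open>Ray l k\<close> is the vertex at distance \<open>k\<close> from the centre on the \<open>l\<close>-th ray; rays are
  numbered from \<open>0\<close>. Simple undirected graphs are symmetric, loop-free pair digraphs.\<close>

datatype star_vertex = Centre | Ray nat nat

inductive_set star_half_edges :: "nat list \<Rightarrow> (star_vertex \<times> star_vertex) set"
  for ks :: "nat list" where
    "\<lbrakk>l < length ks; 1 \<le> ks ! l\<rbrakk> \<Longrightarrow> (Centre, Ray l 1) \<in> star_half_edges ks"
  | "\<lbrakk>l < length ks; 1 \<le> k; k + 1 \<le> ks ! l\<rbrakk> \<Longrightarrow> (Ray l k, Ray l (k + 1)) \<in> star_half_edges ks"

definition star_graph :: "nat list \<Rightarrow> star_vertex pair_pre_digraph" where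
  "star_graph ks =
     \<lparr> pverts = insert Centre {Ray l k | l k. l < length ks \<and> 1 \<le> k \<and> k \<le> ks ! l},
       parcs = star_half_edges ks \<union> (star_half_edges ks)\<inverse> \<rparr>"


section \<open>Bipartition and Perron-Frobenius vector\<close>

definition walk_dist :: "'v pair_pre_digraph \<Rightarrow> 'v \<Rightarrow> 'v \<Rightarrow> nat" where
  "walk_dist G x y = (LEAST n. (x, y) \<in> parcs G ^^ n)"

definition even_verts :: "'v pair_pre_digraph \<Rightarrow> 'v \<Rightarrow> 'v set" where
  "even_verts G A = {x \<in> pverts G. even (walk_dist G A x)}"

definition odd_verts :: "'v pair_pre_digraph \<Rightarrow> 'v \<Rightarrow> 'v set" where
  "odd_verts G A = {x \<in> pverts G. odd (walk_dist G A x)}"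

definition adjacency_op ::
  "'v pair_pre_digraph \<Rightarrow> ('v \<Rightarrow> 'a::comm_monoid_add) \<Rightarrow> 'v \<Rightarrow> 'a" where
  "adjacency_op G f x = (\<Sum>y\<in>{y \<in> pverts G. (x, y) \<in> parcs G}. f y)"

definition adjacency_eigenvalue :: "'v pair_pre_digraph \<Rightarrow> complex \<Rightarrow> bool" where
  "adjacency_eigenvalue G z \<longleftrightarrow>
     (\<exists>f. (\<exists>x\<in>pverts G. f x \<noteq> 0) \<and> (\<forall>x\<in>pverts G. adjacency_op G f x = z * f x))"

text \<open>A positive eigenvector for the spectral radius; on a finite connected graph it exists
  and is unique up to a positive factor, which cancels in the weight below.\<close>

definition perron_frobenius_vector :: "'v pair_pre_digraph \<Rightarrow> ('v \<Rightarrow> real) \<Rightarrow> bool" where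
  "perron_frobenius_vector G \<mu> \<longleftrightarrow>
     (\<forall>x\<in>pverts G. 0 < \<mu> x) \<and>
     (\<exists>\<rho>. (\<forall>x\<in>pverts G. adjacency_op G \<mu> x = \<rho> * \<mu> x) \<and>
          (\<forall>z. adjacency_eigenvalue G z \<longrightarrow> cmod z \<le> \<rho>))"


section \<open>Bi-unitary connections\<close>

definition common_nbrs :: "'v pair_pre_digraph \<Rightarrow> 'v \<Rightarrow> 'v \<Rightarrow> 'v set" where
  "common_nbrs G x y = {z \<in> pverts G. (x, z) \<in> parcs G \<and> (z, y) \<in> parcs G}"

definition unitary_on :: "'v set \<Rightarrow> ('v \<Rightarrow> 'v \<Rightarrow> complex) \<Rightarrow> bool" where
  "unitary_on J M \<longleftrightarrow>
     (\<forall>x\<in>J. \<forall>y\<in>J. (\<Sum>z\<in>J. M x z * cnj (M y z)) = (if x = y then 1 else 0)) \<and>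
     (\<forall>x\<in>J. \<forall>y\<in>J. (\<Sum>z\<in>J. cnj (M z x) * M z y) = (if x = y then 1 else 0))"

definition conn_weight :: "('v \<Rightarrow> real) \<Rightarrow> 'v \<Rightarrow> 'v \<Rightarrow> 'v \<Rightarrow> 'v \<Rightarrow> real" where
  "conn_weight \<mu> p q r s = sqrt ((\<mu> p * \<mu> s) / (\<mu> q * \<mu> r))"

text \<open>The quadruples \<open>(p, q, r, s)\<close> carrying an entry of a connection. Such an entry, with
  lower indices \<open>q, r\<close> and upper indices \<open>p, s\<close>, is written \<open>u p q r s\<close>; other values
  of \<open>u\<close> are irrelevant.\<close>

definition conn_quads :: "'v pair_pre_digraph \<Rightarrow> 'v \<Rightarrow> ('v \<times> 'v \<times> 'v \<times> 'v) set" where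
  "conn_quads G A =
     {(p, q, r, s). p \<in> even_verts G A \<and> s \<in> even_verts G A \<and>
        q \<in> odd_verts G A \<and> r \<in> odd_verts G A \<and>
        (p, q) \<in> parcs G \<and> (q, s) \<in> parcs G \<and> (p, r) \<in> parcs G \<and> (r, s) \<in> parcs G}"

text \<open>Paths of length 2 may return to their starting point, so \<open>p = s\<close> and \<open>q = r\<close> are
  included. Neighbours of even vertices are odd and conversely, so the common neighbours are
  exactly the row and column indices.\<close>

definition biunitary_connection ::
  "'v pair_pre_digraph \<Rightarrow> 'v \<Rightarrow> ('v \<Rightarrow> real) \<Rightarrow> ('v \<Rightarrow> 'v \<Rightarrow> 'v \<Rightarrow> 'v \<Rightarrow> complex) \<Rightarrow> bool" where
  "biunitary_connection G A \<mu> u \<longleftrightarrow>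
     (\<forall>p\<in>even_verts G A. \<forall>s\<in>even_verts G A. (p, s) \<in> parcs G ^^ 2 \<longrightarrow>
        unitary_on (common_nbrs G p s) (\<lambda>q r. u p q r s)) \<and>
     (\<forall>q\<in>odd_verts G A. \<forall>r\<in>odd_verts G A. (q, r) \<in> parcs G ^^ 2 \<longrightarrow>
        unitary_on (common_nbrs G q r)
          (\<lambda>p s. of_real (conn_weight \<mu> p q r s) * cnj (u p q r s)))"

definition gauge_equivalent ::
  "'v pair_pre_digraph \<Rightarrow> 'v \<Rightarrow> ('v \<Rightarrow> 'v \<Rightarrow> 'v \<Rightarrow> 'v \<Rightarrow> complex) \<Rightarrow>
     ('v \<Rightarrow> 'v \<Rightarrow> 'v \<Rightarrow> 'v \<Rightarrow> complex) \<Rightarrow> bool" where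
  "gauge_equivalent G A u u' \<longleftrightarrow>
     (\<exists>a b c d :: 'v \<Rightarrow> 'v \<Rightarrow> complex.
        (\<forall>x\<in>even_verts G A. \<forall>y\<in>odd_verts G A. (x, y) \<in> parcs G \<longrightarrow>
           cmod (a x y) = 1 \<and> cmod (b y x) = 1 \<and> cmod (c x y) = 1 \<and> cmod (d y x) = 1) \<and>
        (\<forall>(p, q, r, s)\<in>conn_quads G A.
           u' p q r s = a p q * b q s * c p r * d r s * u p q r s))"


section \<open>Basic facts about stars\<close>

lemma star_pair_graph: "pair_graph (star_graph ks)"
proof
  have "pverts (star_graph ks)
      \<subseteq> insert Centre ((\<lambda>(l, k). Ray l k) ` (SIGMA l:{..<length ks}. {..ks ! l}))"
    by (force simp: star_graph_def)
  then show fv: "finite (pverts (star_graph ks))"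
    by (rule finite_subset) auto
  have sub: "e \<in> parcs (star_graph ks) \<Longrightarrow>
      fst e \<in> pverts (star_graph ks) \<and> snd e \<in> pverts (star_graph ks) \<and> fst e \<noteq> snd e" for e
    by (cases e) (auto simp: star_graph_def elim!: star_half_edges.cases)
  then show "finite (parcs (star_graph ks))"
    by (intro finite_subset[OF _ finite_cartesian_product[OF fv fv]]) force
  show "\<And>e. e \<in> parcs (star_graph ks) \<Longrightarrow> fst e \<in> pverts (star_graph ks)"
    "\<And>e. e \<in> parcs (star_graph ks) \<Longrightarrow> snd e \<in> pverts (star_graph ks)"
    "\<And>e. e \<in> parcs (star_graph ks) \<Longrightarrow> fst e \<noteq> snd e"
    using sub by blast+
  show "symmetric (with_proj (star_graph ks))"
    by (auto simp: star_graph_def Digraph.symmetric_def arcs_ends_def arc_to_ends_def sym_def)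
qed

lemma star_walk_dist_Centre: "walk_dist (star_graph ks) Centre Centre = 0"
  by (simp add: walk_dist_def)

lemma star_walk_dist_Ray:
  assumes "l < length ks" "1 \<le> k" "k \<le> ks ! l"
  shows "walk_dist (star_graph ks) Centre (Ray l k) = k"
  unfolding walk_dist_def
proof (rule Least_equality)
  let ?E = "parcs (star_graph ks)"
  have "1 \<le> m \<Longrightarrow> m \<le> ks ! l \<Longrightarrow> (Centre, Ray l m) \<in> ?E ^^ m" for m
  proof (induction m)
    case (Suc m)
    show ?case
    proof (cases "m = 0")
      case True
      then show ?thesis
        using Suc.prems assms(1) star_half_edges.intros(1)[of l ks] by (auto simp: star_graph_def)
    next
      case False
      then have "(Centre, Ray l m) \<in> ?E ^^ m" using Suc by simp
      moreover have "(Ray l m, Ray l (Suc m)) \<in> ?E"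
        using False Suc.prems assms(1) star_half_edges.intros(2)[of l ks m]
        by (auto simp: star_graph_def)
      ultimately show ?thesis by auto
    qed
  qed simp
  then show "(Centre, Ray l k) \<in> ?E ^^ k" using assms by blast
next
  let ?h = "\<lambda>x. case x of Centre \<Rightarrow> 0 | Ray l k \<Rightarrow> k"
  have step: "?h y \<le> Suc (?h x)" if "(x, y) \<in> parcs (star_graph ks)" for x y
    using that by (auto simp: star_graph_def elim!: star_half_edges.cases)
  have "?h y \<le> n" if "(Centre, y) \<in> parcs (star_graph ks) ^^ n" for y n
    using that
  proof (induction n arbitrary: y)
    case (Suc n)
    then obtain z where "(Centre, z) \<in> parcs (star_graph ks) ^^ n"
      "(z, y) \<in> parcs (star_graph ks)" by auto
    then show ?case using Suc.IH[of z] step[of z y] by linarith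
  qed simp
  then show "k \<le> n" if "(Centre, Ray l k) \<in> parcs (star_graph ks) ^^ n" for n
    using that by fastforce
qed

end

theory Submission
  imports Defs
begin

text \<open>For a positive eigenvector \<open>\<mu>\<close>, the discrete Wronskian
  \<open>\<mu>\<^sub>k\<^sup>2 - \<mu>\<^sub>k\<^sub>-\<^sub>1 \<mu>\<^sub>k\<^sub>+\<^sub>1\<close> is constant along each ray, so the entries of a
  connection can be completed along the rays by 2 by 2 rotations with diagonal entries
  \<open>\<mu>\<^sub>n / \<mu>\<^sub>k\<close>, where \<open>n\<close> is the length of the ray. Everything thus reduces to a
  unitary matrix at the centre with prescribed moduli of its entries. For two pairs of equal
  rays such a matrix is built from 2 by 2 blocks: two of them are multiples of the Hadamard
  matrix, the third depends on two phases \<open>p, q\<close>, and the fourth is determined by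
  orthogonality; its moduli impose one real condition on \<open>p, q\<close>, which leaves the
  parameter \<open>t = (Re p)\<^sup>2\<close>. A gauge transformation preserves \<open>p\<^sup>2\<close>, hence \<open>t\<close>.\<close>

section \<open>Adjacency in stars\<close>

text \<open>Index 0 on every ray is the centre, so recurrences along a ray treat its first vertex
  like the others.\<close>

definition ray_node :: "nat \<Rightarrow> nat \<Rightarrow> star_vertex" where
  "ray_node l k = (if k = 0 then Centre else Ray l k)"

lemma ray_node_simps [simp]:
  "ray_node l 0 = Centre" "ray_node l (Suc k) = Ray l (Suc k)"
  "k \<noteq> 0 \<Longrightarrow> ray_node l k = Ray l k"
  by (auto simp: ray_node_def)

lemma star_Ray_mem [simp]:
  "Ray l k \<in> pverts (star_graph ks) \<longleftrightarrow> l < length ks \<and> 1 \<le> k \<and> k \<le> ks ! l"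
  by (auto simp: star_graph_def)

lemma star_Centre_mem [simp]: "Centre \<in> pverts (star_graph ks)"
  by (auto simp: star_graph_def)

lemma star_arc_sym: "(x, y) \<in> parcs (star_graph ks) \<longleftrightarrow> (y, x) \<in> parcs (star_graph ks)"
  by (auto simp: star_graph_def)

lemma star_Centre_arc_iff:
  "(Centre, y) \<in> parcs (star_graph ks) \<longleftrightarrow> (\<exists>l<length ks. 1 \<le> ks ! l \<and> y = Ray l 1)"
  by (auto simp: star_graph_def star_half_edges.simps)

lemma star_Ray_arc_iff:
  "(Ray l k, y) \<in> parcs (star_graph ks) \<longleftrightarrow>
     l < length ks \<and> 1 \<le> k \<and> k \<le> ks ! l \<and>
     (y = ray_node l (k - 1) \<or> k < ks ! l \<and> y = Ray l (Suc k))"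
  by (cases k) (auto simp: star_graph_def star_half_edges.simps ray_node_def)

lemma star_even_verts:
  "x \<in> even_verts (star_graph ks) Centre \<longleftrightarrow>
     x = Centre \<or> (\<exists>l k. x = Ray l k \<and> Ray l k \<in> pverts (star_graph ks) \<and> even k)"
  by (cases x) (auto simp: even_verts_def star_walk_dist_Centre star_walk_dist_Ray)

lemma star_odd_verts:
  "x \<in> odd_verts (star_graph ks) Centre \<longleftrightarrow>
     (\<exists>l k. x = Ray l k \<and> Ray l k \<in> pverts (star_graph ks) \<and> odd k)"
  by (cases x) (auto simp: odd_verts_def star_walk_dist_Centre star_walk_dist_Ray)

lemma star_arc_mem:
  "(x, y) \<in> parcs (star_graph ks) \<Longrightarrow> x \<in> pverts (star_graph ks) \<and> y \<in> pverts (star_graph ks)"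
  by (auto simp: star_graph_def elim!: star_half_edges.cases)

lemma star_nbrs_Ray:
  assumes "Ray l k \<in> pverts (star_graph ks)"
  shows "{y \<in> pverts (star_graph ks). (Ray l k, y) \<in> parcs (star_graph ks)} =
    (if k < ks ! l then {ray_node l (k - 1), Ray l (Suc k)} else {ray_node l (k - 1)})"
  using assms by (auto simp: star_Ray_arc_iff ray_node_def)

lemma star_nbrs_Centre:
  "{y \<in> pverts (star_graph ks). (Centre, y) \<in> parcs (star_graph ks)} =
    (\<lambda>l. Ray l 1) ` {l. l < length ks \<and> 1 \<le> ks ! l}"
  by (auto simp: star_Centre_arc_iff)

lemma common_nbrs_self:
  "common_nbrs (star_graph ks) x x =
    {y \<in> pverts (star_graph ks). (x, y) \<in> parcs (star_graph ks)}"
  by (auto simp: common_nbrs_def star_arc_sym)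

text \<open>A star is a tree, so distinct vertices have at most one common neighbour: all blocks
  with \<open>p \<noteq> s\<close> or \<open>q \<noteq> r\<close> are 1 by 1. The midpoint is either
  a ray vertex or the centre.\<close>

lemma star_common_nbrs_distinct:
  assumes "(x, y) \<in> parcs (star_graph ks) ^^ 2" "x \<noteq> y"
  shows "\<exists>l k. l < length ks \<and> 1 \<le> k \<and> k < ks ! l \<and>
           common_nbrs (star_graph ks) x y = {Ray l k} \<and>
           {x, y} = {ray_node l (k - 1), Ray l (Suc k)}
       \<or> (\<exists>l l'. l < length ks \<and> l' < length ks \<and> l \<noteq> l' \<and> 1 \<le> ks ! l \<and> 1 \<le> ks ! l' \<and>
           common_nbrs (star_graph ks) x y = {Centre} \<and> x = Ray l 1 \<and> y = Ray l' 1)"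
proof -
  let ?E = "parcs (star_graph ks)"
  from assms(1) obtain z where z: "(x, z) \<in> ?E" "(z, y) \<in> ?E"
    by (auto simp: numeral_2_eq_2)
  then have zx: "(z, x) \<in> ?E" by (simp add: star_arc_sym)
  have uniq: "z' = z" if "(x, z') \<in> ?E" "(z', y) \<in> ?E" for z'
    using that z assms(2)
    by (cases x; cases y) (auto simp: star_Ray_arc_iff star_Centre_arc_iff ray_node_def split: if_splits)
  have cn: "common_nbrs (star_graph ks) x y = {z}"
    using uniq z star_arc_mem[OF z(1)] unfolding common_nbrs_def by blast
  show ?thesis
  proof (cases z)
    case Centre
    then show ?thesis using z zx cn assms(2) by (auto simp: star_Centre_arc_iff)
  next
    case (Ray l k)
    then have "{x, y} = {ray_node l (k - 1), Ray l (Suc k)}" "l < length ks" "1 \<le> k" "k < ks ! l"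
      using z zx assms(2) unfolding Ray star_Ray_arc_iff by blast+
    then show ?thesis using cn unfolding Ray by blast
  qed
qed

section \<open>Small unitary matrices\<close>

lemma unitary_on_singleton: "unitary_on {x} M \<longleftrightarrow> cmod (M x x) = 1"
proof -
  have "M x x * cnj (M x x) = 1 \<longleftrightarrow> cmod (M x x) = 1"
    using of_real_eq_1_iff[of "(cmod (M x x))\<^sup>2", where 'a=complex]
    by (simp add: complex_norm_square[symmetric] power2_eq_1_iff del: of_real_eq_1_iff of_real_power)
       (smt (verit) norm_ge_zero)
  then show ?thesis by (auto simp: unitary_on_def mult.commute)
qed

text \<open>A real rotation stays unitary when its first column is multiplied by a phase. Next to
  the centre, \<open>z\<close> absorbs the phase of the central matrix.\<close>

lemma unitary_on_rotation:
  fixes c o' :: real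
  assumes "x \<noteq> y" "c\<^sup>2 + o'\<^sup>2 = 1" "cmod z = 1"
    and M: "M x x = z * of_real c" "M x y = of_real o'" "M y x = - z * of_real o'" "M y y = of_real c"
  shows "unitary_on {x, y} M"
proof -
  have z: "z * cnj z = 1" using assms(3) by (simp add: complex_norm_square[symmetric])
  have zc: "z * a * (cnj z * b) = a * b" "cnj z * a * (z * b) = a * b" for a b
    using z by algebra+
  have co: "of_real c * of_real c + of_real o' * of_real o' = (1::complex)"
    using assms(2) by (metis of_real_add of_real_mult of_real_1 power2_eq_square)
  then have oc: "of_real o' * of_real o' + of_real c * of_real c = (1::complex)"
    by (simp only: add.commute)
  show ?thesis
    using assms(1) unfolding unitary_on_def
    by (simp add: M zc co oc)
qed


section \<open>Eigenvectors on stars\<close>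

locale star_eigenvector =
  fixes ks :: "nat list" and \<mu> :: "star_vertex \<Rightarrow> real" and \<rho> :: real
  assumes ray_length: "l < length ks \<Longrightarrow> 1 \<le> ks ! l"
    and pos: "x \<in> pverts (star_graph ks) \<Longrightarrow> 0 < \<mu> x"
    and eigen: "x \<in> pverts (star_graph ks) \<Longrightarrow> adjacency_op (star_graph ks) \<mu> x = \<rho> * \<mu> x"
begin

abbreviation "G \<equiv> star_graph ks"

text \<open>The square of this value is the constant Wronskian of the ray; 0 at
  \<open>Centre\<close> is a default.\<close>

definition tip :: "star_vertex \<Rightarrow> real" where
  "tip v = (case v of Centre \<Rightarrow> 0 | Ray l k \<Rightarrow> \<mu> (Ray l (ks ! l)))"

lemma tip_Ray: "tip (Ray l k) = \<mu> (Ray l (ks ! l))"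
  by (simp add: tip_def)

lemma tip_pos: "l < length ks \<Longrightarrow> 0 < tip (Ray l k)"
  using ray_length by (auto simp: tip_Ray intro!: pos)

lemma ray_node_pos: "l < length ks \<Longrightarrow> k \<le> ks ! l \<Longrightarrow> 0 < \<mu> (ray_node l k)"
  by (auto simp: ray_node_def intro!: pos)

text \<open>Extending \<open>\<mu>\<close> by 0 beyond the end of the ray gives one recurrence for
  all its vertices.\<close>

lemma ray_recurrence:
  assumes "l < length ks" "1 \<le> k" "k \<le> ks ! l"
  shows "\<mu> (ray_node l (k - 1)) + (if k < ks ! l then \<mu> (Ray l (Suc k)) else 0) = \<rho> * \<mu> (Ray l k)"
  using eigen[of "Ray l k"] assms
  by (auto simp: adjacency_op_def star_nbrs_Ray ray_node_def split: if_splits)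

lemma centre_recurrence: "(\<Sum>l<length ks. \<mu> (Ray l 1)) = \<rho> * \<mu> Centre"
proof -
  have "{l. l < length ks \<and> 1 \<le> ks ! l} = {..<length ks}" using ray_length by auto
  then show ?thesis
    using eigen[of Centre]
    by (simp add: adjacency_op_def star_nbrs_Centre sum.reindex inj_on_def del: One_nat_def)
qed

text \<open>Downward induction from the end of the ray, where the outer value is 0; the step
  eliminates \<open>\<rho>\<close> between two consecutive recurrences.\<close>

lemma ray_wronskian:
  assumes "l < length ks" "1 \<le> k" "k \<le> ks ! l"
  shows "(\<mu> (Ray l k))\<^sup>2 = (tip (Ray l k))\<^sup>2 +
           \<mu> (ray_node l (k - 1)) * (if k < ks ! l then \<mu> (Ray l (Suc k)) else 0)"
  using assms(3,2)
proof (induction rule: inc_induct)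
  case base
  then show ?case by (simp add: tip_Ray)
next
  case (step m)
  define g where "g = (if Suc m < ks ! l then \<mu> (Ray l (Suc (Suc m))) else 0)"
  have "(\<mu> (Ray l (Suc m)))\<^sup>2 = (tip (Ray l m))\<^sup>2 + \<mu> (Ray l m) * g"
    using step by (auto simp: g_def tip_Ray ray_node_def)
  moreover have "\<mu> (Ray l m) + g = \<rho> * \<mu> (Ray l (Suc m))"
    using ray_recurrence[of l "Suc m"] step assms(1) by (auto simp: g_def ray_node_def)
  moreover have "\<mu> (ray_node l (m - 1)) + \<mu> (Ray l (Suc m)) = \<rho> * \<mu> (Ray l m)"
    using ray_recurrence[of l m] step assms(1) by auto
  ultimately have "(\<mu> (Ray l m))\<^sup>2 = (tip (Ray l m))\<^sup>2 + \<mu> (ray_node l (m - 1)) * \<mu> (Ray l (Suc m))"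
    by algebra
  then show ?case using step by simp
qed

text \<open>Read inward from their ends, both rays satisfy the same second-order recurrence with
  value 0 beyond the end, so they are proportional. They share the positive value at the centre, so
  the factor is 1.\<close>

lemma equal_rays:
  assumes "l < length ks" "l' < length ks" "ks ! l = ks ! l'" "1 \<le> k" "k \<le> ks ! l"
  shows "\<mu> (Ray l k) = \<mu> (Ray l' k)"
proof -
  let ?n = "ks ! l"
  let ?t = "\<mu> (Ray l ?n)" and ?t' = "\<mu> (Ray l' ?n)"
  have n: "1 \<le> ?n" using assms(1) ray_length by simp
  have *: "?t' * \<mu> (ray_node l (?n - m)) = ?t * \<mu> (ray_node l' (?n - m))" if "m \<le> ?n" for m
    using that
  proof (induction m rule: induct_nat_012)
    case 0
    then show ?case using n by simp
  next
    case 1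
    then show ?case
      using ray_recurrence[OF assms(1), of ?n] ray_recurrence[OF assms(2), of ?n] n assms(3)
      by simp
  next
    case (ge2 m)
    define k where "k = ?n - Suc m"
    have k: "1 \<le> k" "k < ?n" "?n - m = Suc k" "?n - Suc (Suc m) = k - 1" "?n - Suc m = k"
      using ge2.prems by (auto simp: k_def)
    have "\<mu> (ray_node l (k - 1)) + \<mu> (Ray l (Suc k)) = \<rho> * \<mu> (Ray l k)"
      "\<mu> (ray_node l' (k - 1)) + \<mu> (Ray l' (Suc k)) = \<rho> * \<mu> (Ray l' k)"
      using ray_recurrence[OF assms(1), of k] ray_recurrence[OF assms(2), of k] k(1,2) assms(3)
      by simp_all
    moreover have "?t' * \<mu> (Ray l k) = ?t * \<mu> (Ray l' k)"
      "?t' * \<mu> (Ray l (Suc k)) = ?t * \<mu> (Ray l' (Suc k))"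
      using ge2 k by simp_all
    ultimately show ?case unfolding k(4) by algebra
  qed
  have "?t' = ?t" using *[of ?n] pos[of Centre] by simp
  moreover have "0 < ?t" using n assms(1) by (intro pos) simp
  ultimately show ?thesis using *[of "?n - k"] assms(4,5) by simp
qed

text \<open>The Wronskian at the first ray vertex, with the second vertex and \<open>\<rho>\<close>
  eliminated. Equivalently, the squared moduli prescribed in row \<open>l\<close> of the central
  matrix sum to 1.\<close>

lemma centre_ray_identity:
  assumes "l < length ks"
  shows "(tip (Ray l k))\<^sup>2 = (\<mu> Centre)\<^sup>2 + (\<mu> (Ray l 1))\<^sup>2 - \<mu> (Ray l 1) * (\<Sum>l<length ks. \<mu> (Ray l 1))"
proof -
  define g where "g = (if 1 < ks ! l then \<mu> (Ray l (Suc 1)) else 0)"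
  have "(\<mu> (Ray l 1))\<^sup>2 = (tip (Ray l k))\<^sup>2 + \<mu> Centre * g"
    using ray_wronskian[OF assms, of 1] ray_length[OF assms] by (simp add: g_def tip_Ray)
  moreover have "\<mu> Centre + g = \<rho> * \<mu> (Ray l 1)"
    using ray_recurrence[OF assms, of 1] ray_length[OF assms] by (simp add: g_def)
  ultimately show ?thesis unfolding centre_recurrence by algebra
qed


section \<open>Extending a central block to a connection\<close>

primrec height :: "star_vertex \<Rightarrow> nat" where
  "height Centre = 0"
| "height (Ray l k) = k"

text \<open>The entries with \<open>p \<noteq> s\<close> are phases; the one with \<open>s = Centre\<close> carries the phase of
  \<open>W q q\<close>, which makes the two rows of the rotation at \<open>(q, q)\<close> orthogonal.\<close>

definition star_connection ::
  "(star_vertex \<Rightarrow> star_vertex \<Rightarrow> complex) \<Rightarrow>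
     star_vertex \<Rightarrow> star_vertex \<Rightarrow> star_vertex \<Rightarrow> star_vertex \<Rightarrow> complex" where
  "star_connection W p q r s =
    (if p = Centre \<and> s = Centre then W q r
     else if p = s then
       of_real (if q = r then tip q / \<mu> p
                else (if height q < height r then 1 else -1) * (sqrt (\<mu> q * \<mu> r) / \<mu> p))
     else if height p < height s then 1
     else if s = Centre then - of_real (\<mu> Centre / tip q) * W q q
     else -1)"

lemma conn_weight_diag: "0 < \<mu> p \<Longrightarrow> 0 < \<mu> q \<Longrightarrow> conn_weight \<mu> p q q p = \<mu> p / \<mu> q"
  by (simp add: conn_weight_def real_sqrt_divide)

lemma conn_weight_same_upper: "0 < \<mu> p \<Longrightarrow> conn_weight \<mu> p q r p = \<mu> p / sqrt (\<mu> q * \<mu> r)"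
  by (simp add: conn_weight_def real_sqrt_divide)

lemma ray_wronskian_normalised:
  assumes "l < length ks" "1 \<le> k" "k < ks ! l"
  shows "(tip (Ray l k) / \<mu> (Ray l k))\<^sup>2 +
         (sqrt (\<mu> (ray_node l (k - 1)) * \<mu> (Ray l (Suc k))) / \<mu> (Ray l k))\<^sup>2 = 1"
proof -
  have p: "0 < \<mu> (Ray l k)" "0 < \<mu> (Ray l (Suc k))" "0 < \<mu> (ray_node l (k - 1))"
    using assms ray_node_pos[of l "k - 1"] by (auto intro!: pos)
  then have "(tip (Ray l k))\<^sup>2 + (sqrt (\<mu> (ray_node l (k - 1)) * \<mu> (Ray l (Suc k))))\<^sup>2 = (\<mu> (Ray l k))\<^sup>2"
    using ray_wronskian[of l k] assms by simp
  then show ?thesis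
    unfolding power_divide add_divide_distrib[symmetric] using p(1) by simp
qed

text \<open>The diagonal moduli allow the phase of \<open>W q q\<close> to be split off as a
  unimodular factor; the off-diagonal ones are the 1 by 1 conditions at two different first ray
  vertices.\<close>

context
  fixes W :: "star_vertex \<Rightarrow> star_vertex \<Rightarrow> complex"
  assumes unitary: "unitary_on ((\<lambda>l. Ray l 1) ` {..<length ks}) W"
    and diag: "l < length ks \<Longrightarrow> cmod (W (Ray l 1) (Ray l 1)) = tip (Ray l 1) / \<mu> Centre"
    and off_diag: "l < length ks \<Longrightarrow> l' < length ks \<Longrightarrow> l \<noteq> l' \<Longrightarrow>
      cmod (W (Ray l 1) (Ray l' 1)) = sqrt (\<mu> (Ray l 1) * \<mu> (Ray l' 1)) / \<mu> Centre"
begin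

lemma star_connection_even_unitary:
  assumes p: "p \<in> even_verts G Centre" and s: "s \<in> even_verts G Centre"
    and ps: "(p, s) \<in> parcs G ^^ 2"
  shows "unitary_on (common_nbrs G p s) (\<lambda>q r. star_connection W p q r s)"
proof (cases "p = s")
  case True
  show ?thesis
  proof (cases p)
    case Centre
    have "{l. l < length ks \<and> 1 \<le> ks ! l} = {..<length ks}" using ray_length by auto
    then show ?thesis
      using Centre True unitary
      by (simp add: common_nbrs_self star_nbrs_Centre star_connection_def del: One_nat_def)
  next
    case (Ray l k)
    \<comment> \<open>The distance is even and positive, so the inner neighbour is a ray vertex, not
      the centre.\<close>
    have lk: "l < length ks" "2 \<le> k" "k \<le> ks ! l"
      using p Ray by (auto simp: star_even_verts elim!: evenE)
    then have P: "0 < \<mu> (Ray l k)" by (intro pos) simp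
    show ?thesis
    proof (cases "k < ks ! l")
      case k: True
      have "common_nbrs G p s = {Ray l (k - 1), Ray l (Suc k)}"
        unfolding True[symmetric] Ray common_nbrs_self using k lk by (simp add: star_nbrs_Ray)
      moreover have "unitary_on {Ray l (k - 1), Ray l (Suc k)} (\<lambda>q r. star_connection W p q r s)"
      proof (rule unitary_on_rotation[where z = 1])
        show "(tip (Ray l k) / \<mu> (Ray l k))\<^sup>2 +
            (sqrt (\<mu> (Ray l (k - 1)) * \<mu> (Ray l (Suc k))) / \<mu> (Ray l k))\<^sup>2 = 1"
          using ray_wronskian_normalised[of l k] lk k by simp
      qed (use True Ray lk in \<open>auto simp: star_connection_def tip_Ray mult.commute\<close>)
      ultimately show ?thesis by simp
    next
      case k: False
      have "common_nbrs G p s = {Ray l (k - 1)}" "k = ks ! l"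
        unfolding True[symmetric] Ray common_nbrs_self using k lk by (simp_all add: star_nbrs_Ray)
      then show ?thesis
        using True Ray P by (auto simp: unitary_on_singleton star_connection_def tip_Ray)
    qed
  qed
next
  case False
  \<comment> \<open>Neighbours of the centre are odd, so distinct even vertices are never joined
    through it.\<close>
  have "\<not> (p = Ray l 1 \<and> s = Ray l' 1)" for l l'
    using p by (auto simp: star_even_verts)
  then obtain l k where lk: "l < length ks" "1 \<le> k" "k < ks ! l"
    and c: "common_nbrs G p s = {Ray l k}"
    and e: "{p, s} = {ray_node l (k - 1), Ray l (Suc k)}"
    using star_common_nbrs_distinct[OF ps False] by metis
  have t: "0 < tip (Ray l k)" "0 < \<mu> Centre" using tip_pos lk pos by auto
  have "cmod (star_connection W p (Ray l k) (Ray l k) s) = 1"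
  proof (cases "p = Ray l (Suc k)")
    case True
    then have s: "s = ray_node l (k - 1)" using e False by auto
    show ?thesis
    proof (cases "k = 1")
      case k: True
      then show ?thesis
        using s True t diag[of l] lk
        by (simp add: star_connection_def norm_mult norm_divide tip_Ray)
    next
      case k: False
      then show ?thesis using s True lk by (simp add: star_connection_def)
    qed
  next
    case p': False
    then have "p = ray_node l (k - 1)" "s = Ray l (Suc k)" using e False by auto
    then show ?thesis by (auto simp: star_connection_def ray_node_def)
  qed
  then show ?thesis unfolding c unitary_on_singleton .
qed

text \<open>For \<open>q = r\<close> the weight rescales the entries to cosines and sines, up to
  phases; for \<open>q \<noteq> r\<close> it cancels the modulus of the single entry.\<close>

lemma star_connection_odd_unitary:
  assumes q: "q \<in> odd_verts G Centre" and r: "r \<in> odd_verts G Centre"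
    and qr: "(q, r) \<in> parcs G ^^ 2"
  shows "unitary_on (common_nbrs G q r)
    (\<lambda>p s. of_real (conn_weight \<mu> p q r s) * cnj (star_connection W p q r s))"
    (is "unitary_on _ ?v")
proof (cases "q = r")
  case True
  obtain l k where Ray: "q = Ray l k" "l < length ks" "1 \<le> k" "k \<le> ks ! l"
    using q by (auto simp: star_odd_verts)
  then have P: "0 < \<mu> q" "0 < \<mu> Centre" "0 < \<mu> (ray_node l (k - 1))" "0 < tip q"
    using ray_node_pos[of l "k - 1"] tip_pos pos by auto
  \<comment> \<open>The phase of the inner diagonal entry: that of \<open>cnj (W q q)\<close> next
    to the centre, trivial further out.\<close>
  define z where "z = (if k = 1 then of_real (\<mu> Centre / tip q) * cnj (W q q) else 1)"
  have z: "cmod z = 1"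
    using P Ray diag[of l] by (auto simp: z_def norm_mult norm_divide)
  have v1: "?v (ray_node l (k - 1)) (ray_node l (k - 1)) = z * of_real (tip q / \<mu> q)"
    using P Ray True
    by (cases "k = 1") (auto simp: z_def star_connection_def conn_weight_diag)
  show ?thesis
  proof (cases "k < ks ! l")
    case k: True
    define o' where "o' = sqrt (\<mu> (ray_node l (k - 1)) * \<mu> (Ray l (Suc k))) / \<mu> q"
    have P': "0 < \<mu> (Ray l (Suc k))" using k Ray by (intro pos) auto
    have w: "conn_weight \<mu> (ray_node l (k - 1)) q q (Ray l (Suc k)) = o'"
      "conn_weight \<mu> (Ray l (Suc k)) q q (ray_node l (k - 1)) = o'"
      using P by (auto simp: conn_weight_def o'_def real_sqrt_divide mult.commute)
    have n: "ray_node l (k - 1) \<noteq> Ray l (Suc k)" by (auto simp: ray_node_def)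
    have "common_nbrs G q r = {ray_node l (k - 1), Ray l (Suc k)}"
      unfolding True[symmetric] Ray(1) common_nbrs_self using Ray k by (simp add: star_nbrs_Ray)
    moreover have "unitary_on {ray_node l (k - 1), Ray l (Suc k)} ?v"
    proof (rule unitary_on_rotation[where M = ?v, OF n _ z v1])
      show "(tip q / \<mu> q)\<^sup>2 + o'\<^sup>2 = 1"
        using ray_wronskian_normalised[of l k] Ray k by (simp add: o'_def)
      show "?v (ray_node l (k - 1)) (Ray l (Suc k)) = of_real o'"
        using w True n by (auto simp: star_connection_def ray_node_def)
      show "?v (Ray l (Suc k)) (ray_node l (k - 1)) = - z * of_real o'"
        using w True n Ray by (auto simp: star_connection_def ray_node_def z_def)
      show "?v (Ray l (Suc k)) (Ray l (Suc k)) = of_real (tip q / \<mu> q)"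
        using P P' True by (simp add: star_connection_def conn_weight_diag)
    qed
    ultimately show ?thesis by simp
  next
    case k: False
    then have "common_nbrs G q r = {ray_node l (k - 1)}"
      unfolding True[symmetric] Ray(1) common_nbrs_self using Ray k by (simp add: star_nbrs_Ray)
    moreover have "tip q = \<mu> q" using Ray k by (simp add: tip_Ray)
    ultimately show ?thesis using v1 z P by (simp add: unitary_on_singleton)
  qed
next
  case False
  have qr_pos: "0 < \<mu> q" "0 < \<mu> r" using q r by (auto simp: odd_verts_def intro!: pos)
  consider l k where "l < length ks" "1 \<le> k" "k < ks ! l"
    "common_nbrs G q r = {Ray l k}" "{q, r} = {ray_node l (k - 1), Ray l (Suc k)}"
    | l l' where "l < length ks" "l' < length ks" "l \<noteq> l'"
      "common_nbrs G q r = {Centre}" "q = Ray l 1" "r = Ray l' 1"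
    using star_common_nbrs_distinct[OF qr False] by metis
  then show ?thesis
  proof cases
    case 1
    then have "0 < \<mu> (Ray l k)" by (intro pos) auto
    with 1 qr_pos show ?thesis
      by (simp add: unitary_on_singleton star_connection_def conn_weight_same_upper
          norm_mult norm_divide False)
  next
    case 2
    then show ?thesis
      using pos[of Centre] qr_pos off_diag[of l l']
      by (simp add: unitary_on_singleton star_connection_def conn_weight_same_upper norm_mult norm_divide)
  qed
qed

lemma star_connection_biunitary: "biunitary_connection G Centre \<mu> (star_connection W)"
  using star_connection_even_unitary star_connection_odd_unitary
  by (auto simp: biunitary_connection_def)

end

text \<open>\<open>W t\<close> enters only for \<open>s = Centre\<close>: as a whole if
  \<open>p = Centre\<close>, through its diagonal otherwise.\<close>

lemma star_connection_continuous:
  assumes "\<And>l l'. l < length ks \<Longrightarrow> l' < length ks \<Longrightarrow>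
      continuous_on I (\<lambda>t. W t (Ray l 1) (Ray l' 1))"
    and "(p, q, r, s) \<in> conn_quads G Centre"
  shows "continuous_on I (\<lambda>t. star_connection (W t) p q r s)"
proof -
  have C: "\<exists>l<length ks. x = Ray l 1" if "(Centre, x) \<in> parcs G \<or> (x, Centre) \<in> parcs G" for x
    using that star_arc_sym by (auto simp: star_Centre_arc_iff)
  have diag: "continuous_on I (\<lambda>t. W t q q)" if "s = Centre"
    using assms(1) C[of q] assms(2) that by (auto simp: conn_quads_def)
  consider "p = Centre" "s = Centre" | "p \<noteq> s" "\<not> height p < height s" "s = Centre"
    | "p = s" "p \<noteq> Centre" | "p \<noteq> s" "height p < height s \<or> s \<noteq> Centre"
    by blast
  then show ?thesis
  proof cases
    case 1
    then show ?thesis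
      using assms(1) C[of q] C[of r] assms(2) by (auto simp: conn_quads_def star_connection_def)
  next
    case 2
    then have "star_connection (W t) p q r s = - of_real (\<mu> Centre / tip q) * W t q q" for t
      by (auto simp: star_connection_def)
    then show ?thesis using diag[OF 2(3)] by (simp only:) (intro continuous_intros)
  next
    case 3
    \<comment> \<open>Putting the zero matrix in place of \<open>W t\<close> exhibits the entry as a
      constant.\<close>
    then have "star_connection (W t) p q r s = star_connection (\<lambda>_ _. 0) p q r s" for t
      by (auto simp: star_connection_def)
    then show ?thesis by simp
  next
    case 4
    then have "star_connection (W t) p q r s = star_connection (\<lambda>_ _. 0) p q r s" for t
      by (auto simp: star_connection_def)
    then show ?thesis by simp
  qed
qed

end


section \<open>The central block for two pairs of equal rays\<close>

lemma unitary_on_image: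
  assumes "inj_on g J"
  shows "unitary_on (g ` J) M \<longleftrightarrow> unitary_on J (\<lambda>x y. M (g x) (g y))"
  using assms by (auto simp: unitary_on_def sum.reindex inj_on_eq_iff)

text \<open>The block matrix with blocks \<open>A\<close>, \<open>h H\<close>, \<open>h H\<close>, \<open>- H A\<^sup>* H / 2\<close>, where
  \<open>H\<close> is the 2 by 2 Hadamard matrix and \<open>A\<close> has rows \<open>(a p, x q)\<close>, \<open>(- x q\<^sup>*, a p\<^sup>*)\<close>
  for \<open>p = c + i d\<close> and \<open>q = e + i f\<close>; the last block makes the rows orthogonal.\<close>

definition central_block ::
  "real \<Rightarrow> real \<Rightarrow> real \<Rightarrow> real \<Rightarrow> real \<Rightarrow> real \<Rightarrow> real \<Rightarrow> complex list list" where
  "central_block a x h c d e f =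
    [[Complex (a * c) (a * d), Complex (x * e) (x * f), of_real h, of_real h],
     [Complex (- x * e) (x * f), Complex (a * c) (- a * d), of_real h, - of_real h],
     [of_real h, of_real h, Complex (- a * c) (x * f), Complex (- x * e) (a * d)],
     [of_real h, - of_real h, Complex (x * e) (a * d), Complex (- a * c) (- x * f)]]"

lemma lessThan_4: "{..<4::nat} = {0, 1, 2, 3}"
  by auto

text \<open>\<open>A\<close> is \<open>sqrt (a^2 + x^2)\<close> times a unitary and \<open>H\<close>
  is \<open>sqrt 2\<close> times one, so each row and column of the block matrix has squared norm
  \<open>a^2 + x^2 + 2 h^2\<close>.\<close>

lemma unitary_on_central_block:
  assumes cd: "c\<^sup>2 + d\<^sup>2 = 1" and ef: "e\<^sup>2 + f\<^sup>2 = 1"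
    and b: "a\<^sup>2 + x\<^sup>2 + 2 * h\<^sup>2 = b\<^sup>2" "0 < b"
  shows "unitary_on {..<4} (\<lambda>l l'. central_block a x h c d e f ! l ! l' / of_real b)"
proof -
  let ?M = "\<lambda>l l'. central_block a x h c d e f ! l ! l'"
  \<comment> \<open>Written this way, \<open>b^2\<close> turns all inner products into polynomial
    identities in the coordinates.\<close>
  have D: "(a * c)\<^sup>2 + (a * d)\<^sup>2 + (x * e)\<^sup>2 + (x * f)\<^sup>2 + 2 * h\<^sup>2 = b\<^sup>2"
    using cd ef b(1) by algebra
  have rows: "(\<Sum>z<4. ?M l z * cnj (?M m z)) = (if l = m then of_real (b\<^sup>2) else 0)"
    if "l \<in> {..<4}" "m \<in> {..<4}" for l m
    using that unfolding lessThan_4 D[symmetric]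
    by (auto simp: central_block_def complex_eq_iff power2_eq_square algebra_simps)
  have columns: "(\<Sum>z<4. cnj (?M z l) * ?M z m) = (if l = m then of_real (b\<^sup>2) else 0)"
    if "l \<in> {..<4}" "m \<in> {..<4}" for l m
    using that unfolding lessThan_4 D[symmetric]
    by (auto simp: central_block_def complex_eq_iff power2_eq_square algebra_simps)
  show ?thesis
    using b(2) rows columns
    by (simp add: unitary_on_def sum_divide_distrib[symmetric] power2_eq_square)
qed

primrec ray_index :: "star_vertex \<Rightarrow> nat" where
  "ray_index Centre = 0"
| "ray_index (Ray l k) = l"

theorem mainTheorem6:
  fixes i j :: nat and \<mu> :: "star_vertex \<Rightarrow> real"
  assumes "1 \<le> i" and "1 \<le> j"
    and "perron_frobenius_vector (star_graph [i, i, j, j]) \<mu>"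
  shows "\<exists>(I :: real set)
            (u :: real \<Rightarrow> star_vertex \<Rightarrow> star_vertex \<Rightarrow> star_vertex \<Rightarrow> star_vertex \<Rightarrow> complex).
     is_interval I \<and> (\<exists>x\<in>I. \<exists>y\<in>I. x < y) \<and>
     (\<forall>t\<in>I. biunitary_connection (star_graph [i, i, j, j]) Centre \<mu> (u t)) \<and>
     (\<forall>(p, q, r, s)\<in>conn_quads (star_graph [i, i, j, j]) Centre.
        continuous_on I (\<lambda>t. u t p q r s)) \<and>
     (\<forall>t\<in>I. \<forall>t'\<in>I. t \<noteq> t' \<longrightarrow>
        \<not> gauge_equivalent (star_graph [i, i, j, j]) Centre (u t) (u t'))"
proof -
  define ks where "ks = [i, i, j, j]"
  obtain \<rho> where "star_eigenvector ks \<mu> \<rho>"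
    using assms unfolding perron_frobenius_vector_def ks_def
    by (auto simp: star_eigenvector_def less_Suc_eq)
  then interpret star_eigenvector ks \<mu> \<rho> .
  have ks: "length ks = 4" "ks ! 0 = i" "ks ! 1 = i" "ks ! 2 = j" "ks ! 3 = j"
    by (simp_all add: ks_def numeral_2_eq_2 numeral_3_eq_3)
  define b where "b = \<mu> Centre"
  define x where "x = \<mu> (Ray 0 1)"
  define y where "y = \<mu> (Ray 2 1)"
  define a where "a = tip (Ray 0 1)"
  define g where "g = tip (Ray 2 1)"
  define h where "h = sqrt (x * y)"
  have eq: "\<mu> (Ray 1 1) = x" "\<mu> (Ray 3 1) = y" "tip (Ray 1 1) = a" "tip (Ray 3 1) = g"
    using equal_rays[of 0 1] equal_rays[of 2 3] ks assms(1,2)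
    by (simp_all add: x_def y_def a_def g_def tip_Ray)
  have gt0: "0 < b" "0 < x" "0 < y" "0 < a" "0 < g"
    using ks assms(1,2) tip_pos pos by (auto simp: b_def x_def y_def a_def g_def)
  have S: "(\<Sum>l<length ks. \<mu> (Ray l 1)) = 2 * x + 2 * y"
    unfolding ks(1) lessThan_4 using eq by (simp add: x_def y_def)
  have "a\<^sup>2 = b\<^sup>2 + x\<^sup>2 - x * (2 * x + 2 * y)" "g\<^sup>2 = b\<^sup>2 + y\<^sup>2 - y * (2 * x + 2 * y)"
    using centre_ray_identity[of 0 1] centre_ray_identity[of 2 1] ks(1) unfolding S
    by (simp_all add: a_def g_def b_def x_def y_def)
  \<comment> \<open>The row norms in both pairs of rays: \<open>a^2 + x^2\<close> and
    \<open>g^2 + y^2\<close> both equal \<open>b^2 - 2 x y\<close>.\<close>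
  then have ab: "a\<^sup>2 + x\<^sup>2 + 2 * (x * y) = b\<^sup>2" and gb: "g\<^sup>2 + y\<^sup>2 = a\<^sup>2 + x\<^sup>2"
    by algebra+
  have hh: "h\<^sup>2 = x * y" using gt0 by (simp add: h_def)

  \<comment> \<open>The bounds say \<open>0 \<le> t \<le> 1\<close> and, by \<open>gb\<close>,
    \<open>0 \<le> F t \<le> 1\<close>, so that \<open>t = (Re p)^2\<close> and
    \<open>F t = (Im q)^2\<close> are possible.\<close>
  define I where "I = {max 0 (1 - y\<^sup>2 / a\<^sup>2) .. min 1 (g\<^sup>2 / a\<^sup>2)}"
  \<comment> \<open>Solves \<open>a^2 t + x^2 F t = g^2\<close>, the modulus condition on the
    diagonal of the last block; its off-diagonal condition then follows from
    \<open>gb\<close>.\<close>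
  define F where "F t = (g\<^sup>2 - a\<^sup>2 * t) / x\<^sup>2" for t
  define B where "B t = central_block a x h (sqrt t) (sqrt (1 - t)) (sqrt (1 - F t)) (sqrt (F t))" for t
  define W where "W t v w = B t ! ray_index v ! ray_index w / of_real b" for t v w
  define u where "u t = star_connection (W t)" for t
  have I: "0 \<le> t" "t \<le> 1" "0 \<le> F t" "F t \<le> 1" if "t \<in> I" for t
  proof -
    have "1 - y\<^sup>2 / a\<^sup>2 \<le> t" "t \<le> g\<^sup>2 / a\<^sup>2" using that by (auto simp: I_def)
    then have "a\<^sup>2 - y\<^sup>2 \<le> a\<^sup>2 * t" "a\<^sup>2 * t \<le> g\<^sup>2" using gt0 by (auto simp: field_simps)
    then show "0 \<le> F t" "F t \<le> 1" using gb gt0 by (auto simp: F_def)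
  qed (use that in \<open>auto simp: I_def\<close>)
  have interval: "is_interval I" unfolding I_def by (rule is_interval_cc)
  have "max 0 (1 - y\<^sup>2 / a\<^sup>2) < min 1 (g\<^sup>2 / a\<^sup>2)"
  proof -
    \<comment> \<open>By \<open>gb\<close> the left side is \<open>g^2 - x^2\<close>. The other
      three comparisons of endpoints are positivity.\<close>
    have "a\<^sup>2 - y\<^sup>2 < g\<^sup>2" using gb gt0 zero_less_power[of x 2] by linarith
    then have "(a\<^sup>2 - y\<^sup>2) / a\<^sup>2 < g\<^sup>2 / a\<^sup>2"
      using gt0 by (intro divide_strict_right_mono) auto
    then have "1 - y\<^sup>2 / a\<^sup>2 < g\<^sup>2 / a\<^sup>2" using gt0 by (simp add: diff_divide_distrib)
    then show ?thesis using gt0 by simp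
  qed
  then have nondegenerate: "\<exists>x\<in>I. \<exists>y\<in>I. x < y"
    unfolding I_def by (meson atLeastAtMost_iff less_imp_le order_refl)

  have biunitary: "biunitary_connection G Centre \<mu> (u t)" if t: "t \<in> I" for t
    unfolding u_def
  proof (rule star_connection_biunitary)
    note It = I[OF t]
    have "unitary_on {..<4} (\<lambda>l l'. B t ! l ! l' / of_real b)"
      unfolding B_def using It gt0 ab hh by (intro unitary_on_central_block) auto
    then show "unitary_on ((\<lambda>l. Ray l 1) ` {..<length ks}) (W t)"
      unfolding ks(1) by (subst unitary_on_image) (auto simp: inj_on_def W_def)
    have "x\<^sup>2 * F t = g\<^sup>2 - a\<^sup>2 * t" using gt0 by (simp add: F_def)
    moreover from this have "x\<^sup>2 * (1 - F t) = y\<^sup>2 - a\<^sup>2 * (1 - t)"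
      using gb by algebra
    ultimately have xF: "a\<^sup>2 * t + x\<^sup>2 * F t = g\<^sup>2" "x\<^sup>2 * (1 - F t) + a\<^sup>2 * (1 - t) = y\<^sup>2"
      by simp_all
    have cmod_B: "cmod (B t ! l ! l') = (if l = l' then tip (Ray l 1) else sqrt (\<mu> (Ray l 1) * \<mu> (Ray l' 1)))"
      if "l \<in> {..<4}" "l' \<in> {..<4}" for l l'
    proof -
      \<comment> \<open>The squared moduli of the entries in the first block, then, below, in the
        last one.\<close>
      have "(a * sqrt t)\<^sup>2 + (a * sqrt (1 - t))\<^sup>2 = a\<^sup>2"
        "(x * sqrt (1 - F t))\<^sup>2 + (x * sqrt (F t))\<^sup>2 = x\<^sup>2"
        using It gt0 by (simp_all add: power_mult_distrib distrib_left[symmetric])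
      moreover have "(a * sqrt t)\<^sup>2 + (x * sqrt (F t))\<^sup>2 = g\<^sup>2"
        "(x * sqrt (1 - F t))\<^sup>2 + (a * sqrt (1 - t))\<^sup>2 = y\<^sup>2"
        using It xF by (simp_all add: power_mult_distrib)
      ultimately show ?thesis
        using that gt0 unfolding lessThan_4
        by (auto simp: B_def central_block_def eq[simplified] h_def mult.commute
            power2_eq_square[symmetric]
            a_def[symmetric, simplified] g_def[symmetric, simplified]
            x_def[symmetric, simplified] y_def[symmetric, simplified] cmod_def)
    qed
    show "cmod (W t (Ray l 1) (Ray l 1)) = tip (Ray l 1) / \<mu> Centre" if "l < length ks" for l
      using cmod_B[of l l] that ks(1) gt0 by (simp add: W_def norm_divide b_def)
    show "cmod (W t (Ray l 1) (Ray l' 1)) = sqrt (\<mu> (Ray l 1) * \<mu> (Ray l' 1)) / \<mu> Centre"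
      if "l < length ks" "l' < length ks" "l \<noteq> l'" for l l'
      using cmod_B[of l l'] that ks(1) gt0 by (simp add: W_def norm_divide b_def)
  qed

  have continuous: "continuous_on I (\<lambda>t. u t p q r s)"
    if "(p, q, r, s) \<in> conn_quads G Centre" for p q r s
    unfolding u_def
  proof (rule star_connection_continuous[OF _ that])
    fix l l' assume "l < length ks" "l' < length ks"
    then have "l \<in> {0, 1, 2, 3}" "l' \<in> {0, 1, 2, 3}" unfolding ks(1) by auto
    moreover have "continuous_on I F"
      using gt0 unfolding F_def by (intro continuous_intros) auto
    ultimately show "continuous_on I (\<lambda>t. W t (Ray l 1) (Ray l' 1))"
      using gt0
      by (auto simp: W_def B_def central_block_def Complex_eq intro!: continuous_intros)
  qed

  have inequivalent: "t = t'"
    if t: "t \<in> I" "t' \<in> I" and equiv: "gauge_equivalent G Centre (u t) (u t')" for t t'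
  proof -
    obtain \<alpha> \<beta> \<gamma> \<delta> where
      gauge: "\<forall>(p, q, r, s)\<in>conn_quads G Centre.
           u t' p q r s = \<alpha> p q * \<beta> q s * \<gamma> p r * \<delta> r s * u t p q r s"
      using equiv unfolding gauge_equivalent_def by blast
    \<comment> \<open>At the centre a gauge transformation multiplies rows by \<open>\<phi>\<close>
      and columns by \<open>\<psi>\<close>.\<close>
    define \<phi> where "\<phi> l = \<alpha> Centre (Ray l 1) * \<beta> (Ray l 1) Centre" for l
    define \<psi> where "\<psi> l = \<gamma> Centre (Ray l 1) * \<delta> (Ray l 1) Centre" for l
    have B: "B t' ! l ! l' = \<phi> l * \<psi> l' * B t ! l ! l'" if "l < 4" "l' < 4" for l l'
    proof -
      have "1 \<le> ks ! l" "1 \<le> ks ! l'" using ray_length that ks(1) by auto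
      then have "(Centre, Ray l 1, Ray l' 1, Centre) \<in> conn_quads G Centre"
        using that ks(1) star_arc_sym
        by (auto simp: conn_quads_def star_even_verts star_odd_verts star_Centre_arc_iff
            star_arc_sym[of "Ray _ _" Centre])
      with gauge have "u t' Centre (Ray l 1) (Ray l' 1) Centre =
          \<phi> l * \<psi> l' * u t Centre (Ray l 1) (Ray l' 1) Centre"
        by (auto simp: \<phi>_def \<psi>_def mult.assoc)
      then show ?thesis using gt0 by (simp add: u_def star_connection_def W_def field_simps)
    qed
    have h: "h \<noteq> 0" using gt0 by (simp add: h_def)
    \<comment> \<open>The real off-diagonal blocks force one common factor on the block \<open>A\<close>.\<close>
    have "\<phi> 0 * \<psi> 2 = 1" "\<phi> 1 * \<psi> 2 = 1" "\<phi> 2 * \<psi> 0 = 1" "\<phi> 2 * \<psi> 1 = 1"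
      using B[of 0 2] B[of 1 2] B[of 2 0] B[of 2 1] h
      by (simp_all add: B_def central_block_def)
    then have \<phi>\<psi>: "\<phi> 0 * \<psi> 0 = \<phi> 1 * \<psi> 1" by algebra
    define z where "z = \<phi> 0 * \<psi> 0"
    define P where "P t = Complex (sqrt t) (sqrt (1 - t))" for t
    have P: "B t ! 0 ! 0 = of_real a * P t" "B t ! 1 ! 1 = of_real a * cnj (P t)" for t
      by (simp_all add: B_def central_block_def P_def complex_eq_iff)
    have "of_real a * P t' = z * (of_real a * P t)"
      "of_real a * cnj (P t') = z * (of_real a * cnj (P t))"
      using B[of 0 0] B[of 1 1, folded \<phi>\<psi>] unfolding P z_def by simp_all
    then have z: "P t' = z * P t" "cnj (P t') = z * cnj (P t)"
      using gt0 by (simp_all add: mult.left_commute[of z])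
    have "P t * cnj (P t) = 1" if "t \<in> I" for t
      using I[OF that] by (simp add: P_def complex_eq_iff)
    then have "P t * cnj (P t) = 1" "P t' * cnj (P t') = 1" using t by auto
    \<comment> \<open>Multiplying the two relations in \<open>z\<close> gives
      \<open>z^2 = 1\<close>. The real part of the square is \<open>2 t - 1\<close>, which
      determines \<open>t\<close>.\<close>
    then have "(P t')\<^sup>2 = (P t)\<^sup>2" using z by algebra
    then have "Re ((P t')\<^sup>2) = Re ((P t)\<^sup>2)" by simp
    then show ?thesis using I[OF t(1)] I[OF t(2)] by (simp add: P_def Re_power2)
  qed

  show ?thesis
    using interval nondegenerate biunitary continuous inequivalent
    unfolding ks_def by (intro exI[of _ I] exI[of _ u]) blast
qed

end
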